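(* For every positive integer $k$ there exists a bipartite graph $G$ such that $\mu_{\mathrm{int}}(G)=k$.
   Context: Graphs are finite and simple. A $k$-improper edge coloring of a graph $G$ is a map $\alpha:E(G)\to\mathbb{N}$ such that at most $k$ edges with a common endpoint receive the same color; it is an improper interval coloring if at every vertex the colors on incident edges form a set of consecutive integers. The interval coloring impropriety $\mu_{\mathrm{int}}(G)$ is the smallest $k$ such that $G$ has a $k$-improper interval edge coloring. *)

theory Defs
  imports Main "HOL-Library.Ramsey"
begin

definition fin_simple_graph :: "'a set \<Rightarrow> 'a set set \<Rightarrow> bool" where
  "fin_simple_graph V E \<longleftrightarrow> finite V \<and> E \<subseteq> [V]\<^bsup>2\<^esup>"

definition bipartite_graph :: "'a set \<Rightarrow> 'a set set \<Rightarrow> bool" where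
  "bipartite_graph V E \<longleftrightarrow> fin_simple_graph V E \<and>
     (\<exists>X Y. X \<union> Y = V \<and> X \<inter> Y = {} \<and> (\<forall>e\<in>E. \<exists>x\<in>X. \<exists>y\<in>Y. e = {x, y}))"

definition incident_edges :: "'a set set \<Rightarrow> 'a \<Rightarrow> 'a set set" where
  "incident_edges E v = {e \<in> E. v \<in> e}"

text \<open>Edge colorings are total functions; only their values on \<open>E\<close> matter.\<close>

definition improper_edge_coloring ::
    "nat \<Rightarrow> 'a set \<Rightarrow> 'a set set \<Rightarrow> ('a set \<Rightarrow> nat) \<Rightarrow> bool" where
  "improper_edge_coloring k V E \<alpha> \<longleftrightarrow>
     (\<forall>v\<in>V. \<forall>c. card {e \<in> incident_edges E v. \<alpha> e = c} \<le> k)"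

text \<open>The interval \<open>{a..b}\<close> is empty for \<open>a > b\<close>, so isolated vertices impose no condition.\<close>

definition improper_interval_coloring ::
    "nat \<Rightarrow> 'a set \<Rightarrow> 'a set set \<Rightarrow> ('a set \<Rightarrow> nat) \<Rightarrow> bool" where
  "improper_interval_coloring k V E \<alpha> \<longleftrightarrow> improper_edge_coloring k V E \<alpha> \<and>
     (\<forall>v\<in>V. \<exists>a b. \<alpha> ` incident_edges E v = {a..b})"

definition interval_impropriety :: "'a set \<Rightarrow> 'a set set \<Rightarrow> nat" where
  "interval_impropriety V E = (LEAST k. \<exists>\<alpha>. improper_interval_coloring k V E \<alpha>)"

text \<open>The minimum is attained: a constant coloring is \<open>k\<close>-improper for large \<open>k\<close>.\<close>

lemma ex_improper_interval_coloring:
  assumes "fin_simple_graph V E"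
  shows "\<exists>k \<alpha>. improper_interval_coloring k V E \<alpha>"
proof (intro exI)
  have fin: "finite E"
    using assms by (auto simp: fin_simple_graph_def intro: finite_subset finite_imp_finite_nsets)
  have "card {e \<in> incident_edges E v. 0 = c} \<le> card E" for v and c :: nat
    using fin by (intro card_mono) (auto simp: incident_edges_def)
  moreover have "\<exists>a b. (\<lambda>e. 0::nat) ` incident_edges E v = {a..b}" for v
  proof (cases "incident_edges E v = {}")
    case True
    then have "(\<lambda>e. 0::nat) ` incident_edges E v = {1..0}" by simp
    then show ?thesis by blast
  next
    case False
    then have "(\<lambda>e. 0::nat) ` incident_edges E v = {0..0}" by auto
    then show ?thesis by blast
  qed
  ultimately show "improper_interval_coloring (card E) V E (\<lambda>e. 0)"
    by (simp add: improper_interval_coloring_def improper_edge_coloring_def)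
qed

end

theory Submission
  imports Defs
begin

text \<open>
  Giving a clone of a vertex the colors of the original shows that cloning increases the
  impropriety by at most one. Take \<open>n\<close> internally disjoint paths of length three from \<open>a\<close> to \<open>d\<close>
  and clone the neighbors of \<open>d\<close> cyclically. At first the impropriety is at most one. When \<open>d\<close>
  has \<open>n * n\<close> neighbors, all other degrees are still at most \<open>n + 1\<close>, and any two edges at \<open>d\<close>
  are joined by a path of bounded length through the other vertices. Colors change by less than
  the degree at each of these, so only \<open>O(n)\<close> colors appear at \<open>d\<close>, and some color appears on a number of edges at \<open>d\<close> that is linear in \<open>n\<close>.
  Hence every intermediate value is attained on the way.
\<close>

section \<open>Cloning a vertex\<close>

definition clone_edges :: "'a set set \<Rightarrow> 'a \<Rightarrow> 'a \<Rightarrow> 'a set set" where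
  "clone_edges E u v = E \<union> {{v, w} | w. {u, w} \<in> E}"

lemma interval_impropriety_le:
  "improper_interval_coloring k V E \<alpha> \<Longrightarrow> interval_impropriety V E \<le> k"
  unfolding interval_impropriety_def by (rule Least_le) blast

lemma interval_impropriety_attained:
  assumes "fin_simple_graph V E"
  obtains \<alpha> where "improper_interval_coloring (interval_impropriety V E) V E \<alpha>"
  using LeastI_ex[OF ex_improper_interval_coloring[OF assms]]
  unfolding interval_impropriety_def by blast

lemma fin_simple_graph_finite_edges: "fin_simple_graph V E \<Longrightarrow> finite E"
  by (auto simp: fin_simple_graph_def intro: finite_subset finite_imp_finite_nsets)

lemma fin_simple_graph_edgeE:
  assumes "fin_simple_graph V E" "e \<in> E" "w \<in> e"
  obtains x where "e = {w, x}" "x \<noteq> w" "x \<in> V" "w \<in> V"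
proof -
  have "e \<in> [V]\<^bsup>2\<^esup>" using assms by (auto simp: fin_simple_graph_def)
  then have "e \<subseteq> V" "card e = 2" by (auto simp: nsets_def)
  then obtain p q where "e = {p, q}" "p \<noteq> q" by (auto simp: card_2_iff)
  then show thesis using that \<open>w \<in> e\<close> \<open>e \<subseteq> V\<close> by auto
qed

text \<open>Copying the color of \<open>{u, w}\<close> to \<open>{v, w}\<close> gives
  \<open>v\<close> exactly the colors of \<open>u\<close>. A neighbor \<open>w\<close> of
  \<open>u\<close> gains a single edge whose color is already present at \<open>w\<close>, so its
  color set is unchanged and one multiplicity grows by one.\<close>

lemma interval_impropriety_clone_le:
  assumes G: "fin_simple_graph V E" and u: "u \<in> V" and v: "v \<notin> V"
  shows "interval_impropriety (insert v V) (clone_edges E u v) \<le> Suc (interval_impropriety V E)"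
proof -
  let ?k = "interval_impropriety V E" and ?E' = "clone_edges E u v"
  obtain \<alpha> where \<alpha>: "improper_interval_coloring ?k V E \<alpha>"
    using interval_impropriety_attained[OF G] .
  have fin: "finite {e \<in> incident_edges E w. P e}" for w P
    using fin_simple_graph_finite_edges[OF G] by (auto simp: incident_edges_def)
  have v_notin: "v \<notin> e" if "e \<in> E" for e
    using that v fin_simple_graph_edgeE[OF G that] by metis
  \<comment> \<open>\<open>r\<close> undoes the cloning: an edge at \<open>v\<close> goes to its
    original at \<open>u\<close>, an old edge stays. The new coloring is the old one pulled back
    along \<open>r\<close>.\<close>
  define r where "r e = (if v \<in> e then insert u (e - {v}) else e)" for e
  have r_old: "r e = e" if "e \<in> E" for e
    using v_notin[OF that] by (simp add: r_def)
  have r_new: "r {v, w} = {u, w}" if "{u, w} \<in> E" for w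
    using v_notin[OF that] by (auto simp: r_def)
  define \<beta> where "\<beta> e = \<alpha> (r e)" for e
  have inc_v: "incident_edges ?E' v = {{v, w} | w. {u, w} \<in> E}"
    using v_notin by (auto simp: incident_edges_def clone_edges_def)
  have inc_u: "e \<in> incident_edges E u \<longleftrightarrow> (\<exists>w. e = {u, w} \<and> {u, w} \<in> E)" for e
    using fin_simple_graph_edgeE[OF G, of e u] by (auto simp: incident_edges_def)
  have inc_w: "incident_edges ?E' w
      = incident_edges E w \<union> (if {u, w} \<in> E then {{v, w}} else {})" if "w \<in> V" for w
    using that v by (auto simp: incident_edges_def clone_edges_def)
  have "card {e \<in> incident_edges ?E' w. \<beta> e = c} \<le> Suc ?k" if "w \<in> insert v V" for w c
  proof (cases "w = v")
    case True
    \<comment> \<open>Exchanging the endpoint \<open>u\<close> for \<open>v\<close> maps the edges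
      of color \<open>c\<close> at \<open>u\<close> onto those at \<open>v\<close>.\<close>
    have "{e \<in> incident_edges ?E' v. \<beta> e = c}
      \<subseteq> (\<lambda>e. insert v (e - {u})) ` {e \<in> incident_edges E u. \<alpha> e = c}"
    proof
      fix e assume "e \<in> {e \<in> incident_edges ?E' v. \<beta> e = c}"
      then obtain w where w: "e = {v, w}" "{u, w} \<in> E" "\<alpha> {u, w} = c"
        unfolding inc_v \<beta>_def using r_new by auto
      have "u \<noteq> w" using fin_simple_graph_edgeE[OF G w(2), of u] by auto
      then have "e = insert v ({u, w} - {u})" using w by auto
      then show "e \<in> (\<lambda>e. insert v (e - {u})) ` {e \<in> incident_edges E u. \<alpha> e = c}"
        using w by (intro image_eqI[of _ _ "{u, w}"]) (auto simp: incident_edges_def)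
    qed
    then have "card {e \<in> incident_edges ?E' v. \<beta> e = c} \<le> card {e \<in> incident_edges E u. \<alpha> e = c}"
      by (rule surj_card_le[OF fin])
    also have "\<dots> \<le> ?k"
      using \<alpha> u by (simp add: improper_interval_coloring_def improper_edge_coloring_def)
    finally show ?thesis using True by simp
  next
    case False
    then have "w \<in> V" using that by simp
    have "{e \<in> incident_edges ?E' w. \<beta> e = c}
      \<subseteq> insert {v, w} {e \<in> incident_edges E w. \<alpha> e = c}"
      unfolding inc_w[OF \<open>w \<in> V\<close>] by (auto simp: \<beta>_def r_old incident_edges_def)
    then have "card {e \<in> incident_edges ?E' w. \<beta> e = c}
      \<le> card (insert {v, w} {e \<in> incident_edges E w. \<alpha> e = c})"
      by (intro card_mono) (use fin in auto)
    also have "\<dots> \<le> Suc (card {e \<in> incident_edges E w. \<alpha> e = c})"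
      by (rule card_insert_le_m1) auto
    also have "\<dots> \<le> Suc ?k"
      using \<alpha> \<open>w \<in> V\<close> by (auto simp: improper_interval_coloring_def improper_edge_coloring_def)
    finally show ?thesis .
  qed
  moreover have "\<exists>a b. \<beta> ` incident_edges ?E' w = {a..b}" if "w \<in> insert v V" for w
  proof (cases "w = v")
    case True
    have "\<beta> ` incident_edges ?E' v = \<alpha> ` incident_edges E u"
    proof -
      have "incident_edges E u = (\<lambda>w. {u, w}) ` {w. {u, w} \<in> E}"
        using inc_u by blast
      moreover have "incident_edges ?E' v = (\<lambda>w. {v, w}) ` {w. {u, w} \<in> E}"
        unfolding inc_v by blast
      ultimately show ?thesis
        by (simp add: image_image \<beta>_def r_new cong: image_cong_simp)
    qed
    then show ?thesis
      using \<alpha> u True by (auto simp: improper_interval_coloring_def)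
  next
    case False
    then have "w \<in> V" using that by simp
    have "\<beta> ` incident_edges E w = \<alpha> ` incident_edges E w"
      by (rule image_cong) (auto simp: \<beta>_def r_old incident_edges_def)
    moreover have "\<beta> {v, w} \<in> \<alpha> ` incident_edges E w" if "{u, w} \<in> E"
      using that by (auto simp: \<beta>_def r_new incident_edges_def)
    ultimately have "\<beta> ` incident_edges ?E' w = \<alpha> ` incident_edges E w"
      unfolding inc_w[OF \<open>w \<in> V\<close>] by auto
    then show ?thesis
      using \<alpha> \<open>w \<in> V\<close> by (auto simp: improper_interval_coloring_def)
  qed
  ultimately have "improper_interval_coloring (Suc ?k) (insert v V) ?E' \<beta>"
    by (auto simp: improper_interval_coloring_def improper_edge_coloring_def)
  then show ?thesis by (rule interval_impropriety_le)
qed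

section \<open>Number of colors at a single vertex\<close>

text \<open>An interval of colors has no more elements than the vertex has edges, so its ends differ
  by less than the degree.\<close>

lemma improper_interval_coloring_spread:
  assumes "improper_interval_coloring k V E \<alpha>" "v \<in> V" "finite (incident_edges E v)"
    and "card (incident_edges E v) \<le> Suc m"
    and "e \<in> E" "v \<in> e" "e' \<in> E" "v \<in> e'"
  shows "\<alpha> e \<le> \<alpha> e' + m"
proof -
  obtain a b where ab: "\<alpha> ` incident_edges E v = {a..b}"
    using assms(1,2) unfolding improper_interval_coloring_def by blast
  have "\<alpha> e \<in> {a..b}" "\<alpha> e' \<in> {a..b}"
    unfolding ab[symmetric] using assms by (auto simp: incident_edges_def)
  moreover have "card {a..b} \<le> Suc m"
    using card_image_le[of "incident_edges E v" \<alpha>] assms unfolding ab by linarith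
  ultimately show ?thesis by auto
qed

text \<open>Pigeonhole: the colors at \<open>v\<close> lie in a window of \<open>Suc m\<close>
  values starting at the smallest one, and each is used at most \<open>k\<close> times. This turns a
  small spread at a vertex of large degree into a lower bound on \<open>k\<close>.\<close>

lemma card_le_impropriety_times_span:
  assumes "improper_edge_coloring k V E \<alpha>" "v \<in> V" "finite (incident_edges E v)"
    and "\<And>e e'. e \<in> incident_edges E v \<Longrightarrow> e' \<in> incident_edges E v \<Longrightarrow> \<alpha> e \<le> \<alpha> e' + m"
  shows "card (incident_edges E v) \<le> k * Suc m"
proof (cases "incident_edges E v = {}")
  case False
  let ?I = "incident_edges E v" and ?C = "\<alpha> ` incident_edges E v"
  have "?C \<subseteq> {Min ?C..Min ?C + m}"
  proof
    fix c assume "c \<in> ?C"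
    moreover have "Min ?C \<in> ?C" using False assms(3) by (intro Min_in) auto
    ultimately show "c \<in> {Min ?C..Min ?C + m}"
      using assms(3,4) by (smt (verit) Min_le atLeastAtMost_iff finite_imageI image_iff)
  qed
  then have C: "card ?C \<le> Suc m"
    by (metis card_atLeastAtMost card_mono diff_add_inverse finite_atLeastAtMost add_Suc_right)
  have "card ?I = (\<Sum>c\<in>?C. card {e \<in> ?I. \<alpha> e = c})"
    using sum.image_gen[OF assms(3), of "\<lambda>_. 1 :: nat" \<alpha>] by simp
  also have "\<dots> \<le> card ?C * k"
    using sum_bounded_above[of ?C "\<lambda>c. card {e \<in> ?I. \<alpha> e = c}" k] assms(1,2)
    by (auto simp: improper_edge_coloring_def)
  also have "\<dots> \<le> k * Suc m" using mult_le_mono2[OF C, of k] by (simp only: mult.commute)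
  finally show ?thesis .
qed simp

section \<open>The graphs built from paths of length three by cyclic cloning\<close>

text \<open>Vertex \<open>0\<close> is \<open>d\<close>, vertex \<open>1\<close> is \<open>a\<close>, the neighbors of \<open>a\<close> are \<open>2 + i\<close> for \<open>i < n\<close>, and
  those of \<open>d\<close> are \<open>2 + n + p\<close> for \<open>p < N\<close>.\<close>

definition theta_verts :: "nat \<Rightarrow> nat \<Rightarrow> nat set" where
  "theta_verts n N = {..<2 + n + N}"

text \<open>The residue \<open>p mod n\<close> encodes the cyclic cloning: the neighbors of
  \<open>d\<close> with indices \<open>p\<close> and \<open>p + n\<close> hang on the same neighbor
  of \<open>a\<close>. For \<open>N = n\<close> the graph consists of the \<open>n\<close> original
  paths.\<close>

definition theta_edges :: "nat \<Rightarrow> nat \<Rightarrow> nat set set" where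
  "theta_edges n N = (\<lambda>i. {1, 2 + i}) ` {..<n} \<union> (\<lambda>p. {2 + p mod n, 2 + n + p}) ` {..<N}
     \<union> (\<lambda>p. {0, 2 + n + p}) ` {..<N}"

lemma bipartite_theta:
  assumes "0 < n"
  shows "bipartite_graph (theta_verts n N) (theta_edges n N)"
proof -
  have m: "p mod n < n" for p using assms by simp
  have ne: "2 + p mod n \<noteq> 2 + n + p" for p using m[of p] by linarith
  have lt: "2 + p mod n < 2 + n + N" for p using m[of p] by linarith
  have "theta_edges n N \<subseteq> [theta_verts n N]\<^bsup>2\<^esup>"
    using ne lt by (auto simp: theta_edges_def theta_verts_def nsets_def)
  then have "fin_simple_graph (theta_verts n N) (theta_edges n N)"
    by (simp add: fin_simple_graph_def theta_verts_def)
  moreover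
  let ?X = "insert 0 {2..<2 + n}" and ?Y = "insert 1 {2 + n..<2 + n + N}"
  have "?X \<union> ?Y = theta_verts n N" "?X \<inter> ?Y = {}"
    by (auto simp: theta_verts_def)
  moreover have "\<forall>e\<in>theta_edges n N. \<exists>x\<in>?X. \<exists>y\<in>?Y. e = {x, y}"
  proof
    fix e assume "e \<in> theta_edges n N"
    then consider i where "i < n" "e = {2 + i, 1}"
      | p where "p < N" "e = {2 + p mod n, 2 + n + p}"
      | p where "p < N" "e = {0, 2 + n + p}"
      unfolding theta_edges_def by blast
    then show "\<exists>x\<in>?X. \<exists>y\<in>?Y. e = {x, y}"
    proof cases
      case 1
      then show ?thesis by (intro bexI[of _ "2 + i"] bexI[of _ 1]) auto
    next
      case 2
      then show ?thesis using m[of p]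
        by (intro bexI[of _ "2 + p mod n"] bexI[of _ "2 + n + p"]) auto
    next
      case 3
      then show ?thesis by (intro bexI[of _ 0] bexI[of _ "2 + n + p"]) auto
    qed
  qed
  ultimately show ?thesis unfolding bipartite_graph_def by blast
qed

lemma fin_simple_graph_theta: "0 < n \<Longrightarrow> fin_simple_graph (theta_verts n N) (theta_edges n N)"
  using bipartite_theta by (simp add: bipartite_graph_def)

text \<open>Since \<open>n \<le> N\<close>, the vertex \<open>2 + N\<close> is the neighbor of
  \<open>d\<close> with index \<open>N - n\<close>. This index has the same residue as
  \<open>N\<close>, so its clone has the neighbors required of index \<open>N\<close>.\<close>

lemma theta_edges_Suc:
  assumes "0 < n" "n \<le> N"
  shows "theta_edges n (Suc N) = clone_edges (theta_edges n N) (2 + N) (2 + n + N)"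
proof -
  have m: "p mod n < n" for p using assms by simp
  have N: "(N - n) mod n = N mod n" using assms by (simp add: le_mod_geq)
  have nbrs: "{2 + N, w} \<in> theta_edges n N \<longleftrightarrow> w = 0 \<or> w = 2 + N mod n" for w
  proof
    assume "{2 + N, w} \<in> theta_edges n N"
    then consider i where "i < n" "{2 + N, w} = {1, 2 + i}"
      | p where "p < N" "{2 + N, w} = {2 + p mod n, 2 + n + p}"
      | p where "p < N" "{2 + N, w} = {0, 2 + n + p}"
      unfolding theta_edges_def by blast
    then show "w = 0 \<or> w = 2 + N mod n"
    proof cases
      case 1
      then show ?thesis using assms by (auto simp: doubleton_eq_iff)
    next
      case 2
      \<comment> \<open>The neighbors of \<open>a\<close> have numbers below \<open>2 + n\<close>,
        so \<open>2 + N\<close> can only be the other end of the edge.\<close>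
      have "2 + N \<noteq> 2 + p mod n" using m[of p] assms by linarith
      then have "w = 2 + p mod n" "N = n + p"
        using 2(2) unfolding doubleton_eq_iff by linarith+
      then show ?thesis by simp
    next
      case 3
      then show ?thesis by (auto simp: doubleton_eq_iff)
    qed
  next
    assume "w = 0 \<or> w = 2 + N mod n"
    then show "{2 + N, w} \<in> theta_edges n N"
    proof
      assume "w = 0"
      then have "{2 + N, w} = {0, 2 + n + (N - n)}" "N - n < N" using assms by auto
      then show ?thesis unfolding theta_edges_def by blast
    next
      assume "w = 2 + N mod n"
      then have "{2 + N, w} = {2 + (N - n) mod n, 2 + n + (N - n)}" "N - n < N"
        using assms N by auto
      then show ?thesis unfolding theta_edges_def by blast
    qed
  qed
  have "{{2 + n + N, w} | w. {2 + N, w} \<in> theta_edges n N}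
    = {{2 + n + N, 0}, {2 + n + N, 2 + N mod n}}"
    unfolding nbrs by blast
  then show ?thesis
    by (simp only: clone_edges_def theta_edges_def lessThan_Suc image_insert
        Un_insert_left Un_insert_right Un_empty_right insert_commute)
qed

lemma interval_impropriety_theta_Suc:
  assumes "0 < n" "n \<le> N"
  shows "interval_impropriety (theta_verts n (Suc N)) (theta_edges n (Suc N))
    \<le> Suc (interval_impropriety (theta_verts n N) (theta_edges n N))"
proof -
  have "theta_verts n (Suc N) = insert (2 + n + N) (theta_verts n N)"
    by (auto simp: theta_verts_def)
  then show ?thesis
    using interval_impropriety_clone_le[OF fin_simple_graph_theta[OF assms(1)], of "2 + N" N "2 + n + N"]
      theta_edges_Suc[OF assms] assms by (simp add: theta_verts_def)
qed

lemma incident_theta_d: "incident_edges (theta_edges n N) 0 = (\<lambda>p. {0, 2 + n + p}) ` {..<N}"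
  by (auto simp: incident_edges_def theta_edges_def)

lemma incident_theta_a: "incident_edges (theta_edges n N) 1 = (\<lambda>i. {1, 2 + i}) ` {..<n}"
  by (auto simp: incident_edges_def theta_edges_def)

lemma incident_theta_b:
  assumes "i < n"
  shows "incident_edges (theta_edges n N) (2 + i)
    = insert {1, 2 + i} ((\<lambda>p. {2 + i, 2 + n + p}) ` {p. p < N \<and> p mod n = i})"
  using assms by (auto simp: incident_edges_def theta_edges_def)

lemma incident_theta_c:
  assumes "p < N" "0 < n"
  shows "incident_edges (theta_edges n N) (2 + n + p)
    = {{2 + p mod n, 2 + n + p}, {0, 2 + n + p}}"
proof -
  \<comment> \<open>This keeps the neighbors of \<open>a\<close> apart from the neighbors of
    \<open>d\<close>; both orientations are needed when edges are compared as sets.\<close>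
  have "q mod n \<noteq> n + p" for p q
    using mod_less_divisor[OF assms(2), of q] by linarith
  note this [simp] this[symmetric, simp]
  show ?thesis
    using assms(1) by (auto simp: incident_edges_def theta_edges_def)
qed

section \<open>Bounds on the impropriety at the two ends of the cloning process\<close>

text \<open>Color the path with index \<open>i\<close>, from \<open>a\<close> to \<open>d\<close>,
  by \<open>i\<close>, \<open>i + 1\<close>, \<open>i\<close>. Then \<open>a\<close> and
  \<open>d\<close> each see \<open>0\<close> to \<open>n - 1\<close> once, and every inner vertex
  sees \<open>i\<close> and \<open>i + 1\<close>.\<close>

lemma interval_impropriety_theta_diagonal_le:
  assumes "0 < n"
  shows "interval_impropriety (theta_verts n n) (theta_edges n n) \<le> 1"
proof -
  \<comment> \<open>The index of the path is read off the vertex numbers: from the larger end for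
    edges at \<open>d\<close> or \<open>a\<close>, from the smaller end for middle edges.\<close>
  define \<alpha> :: "nat set \<Rightarrow> nat" where
    "\<alpha> e = (if 0 \<in> e then Max e - (2 + n) else if 1 \<in> e then Max e - 2 else Min e - 1)" for e
  have \<alpha>: "\<alpha> {0, 2 + n + i} = i" "\<alpha> {1, 2 + i} = i" "\<alpha> {2 + i, 2 + n + i} = Suc i" for i
    by (auto simp: \<alpha>_def)
  have inc_b: "incident_edges (theta_edges n n) (2 + i) = {{1, 2 + i}, {2 + i, 2 + n + i}}"
    if "i < n" for i
  proof -
    have "{p. p < n \<and> p mod n = i} = {i}" using that by auto
    then show ?thesis by (simp only: incident_theta_b[OF that] image_insert image_empty)
  qed
  have inc_c: "incident_edges (theta_edges n n) (2 + n + i) = {{2 + i, 2 + n + i}, {0, 2 + n + i}}"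
    if "i < n" for i
    using incident_theta_c[OF that assms] that by simp
  have proper: "inj_on \<alpha> (incident_edges (theta_edges n n) v) \<and>
      (\<exists>a b. \<alpha> ` incident_edges (theta_edges n n) v = {a..b})"
    if "v \<in> theta_verts n n" for v
  proof -
    have upto: "{..<n} = {0..n - 1}" using assms by auto
    have "v = 0 \<or> v = 1 \<or> (\<exists>i<n. v = 2 + i) \<or> (\<exists>i<n. v = 2 + n + i)"
      using that unfolding theta_verts_def by simp presburger
    then consider "v = 0" | "v = 1" | i where "i < n" "v = 2 + i" | i where "i < n" "v = 2 + n + i"
      by blast
    then show ?thesis
    proof cases
      case 1
      show ?thesis unfolding 1 incident_theta_d image_image \<alpha> using upto
        by (auto simp: inj_on_def \<alpha>[simplified])
    next
      case 2
      show ?thesis unfolding 2 incident_theta_a image_image \<alpha> using upto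
        by (auto simp: inj_on_def \<alpha>[simplified])
    next
      case 3
      have "{i, Suc i} = {i..Suc i}" by auto
      then show ?thesis unfolding 3 inc_b[OF 3(1)] image_insert image_empty \<alpha>
        by (auto simp: inj_on_def \<alpha>[simplified])
    next
      case 4
      have "{Suc i, i} = {i..Suc i}" by auto
      then show ?thesis unfolding 4 inc_c[OF 4(1)] image_insert image_empty \<alpha>
        by (auto simp: inj_on_def \<alpha>[simplified])
    qed
  qed
  have "card {e \<in> incident_edges (theta_edges n n) v. \<alpha> e = c} \<le> 1"
    if "v \<in> theta_verts n n" for v c
  proof -
    have "finite {e \<in> incident_edges (theta_edges n n) v. \<alpha> e = c}"
      using fin_simple_graph_finite_edges[OF fin_simple_graph_theta[OF assms]]
      by (simp add: incident_edges_def)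
    then show ?thesis
      using proper[OF that] by (auto simp: card_le_Suc0_iff_eq inj_on_def)
  qed
  then have "improper_interval_coloring 1 (theta_verts n n) (theta_edges n n) \<alpha>"
    using proper by (auto simp: improper_interval_coloring_def improper_edge_coloring_def)
  then show ?thesis by (rule interval_impropriety_le)
qed

text \<open>This bounds by \<open>m\<close> the number of edges from a neighbor of \<open>a\<close>
  towards the neighbors of \<open>d\<close>.\<close>

lemma card_residue_class_le:
  assumes "i < (n :: nat)"
  shows "card {p. p < n * m \<and> p mod n = i} \<le> m"
proof -
  have "{p. p < n * m \<and> p mod n = i} \<subseteq> (\<lambda>j. n * j + i) ` {..<m}"
  proof
    fix p assume p: "p \<in> {p. p < n * m \<and> p mod n = i}"
    then have "p = n * (p div n) + i" by auto
    moreover have "p div n < m" using p by (simp add: less_mult_imp_div_less mult.commute)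
    ultimately show "p \<in> (\<lambda>j. n * j + i) ` {..<m}" by blast
  qed
  then show ?thesis using surj_card_le[of "{..<m}"] by simp
qed

text \<open>Between two edges at \<open>d\<close>, a walk avoiding \<open>d\<close> passes vertices
  of degree at most 2, \<open>m + 1\<close>, \<open>n\<close>, \<open>m + 1\<close> and 2. The
  colors differ by at most \<open>1 + m + (n - 1) + m + 1\<close>, so at most
  \<open>n + 2 * m + 2\<close> colors share the \<open>n * m\<close> edges at
  \<open>d\<close>.\<close>

lemma interval_impropriety_theta_ge:
  assumes "0 < n"
  shows "n * m \<le> interval_impropriety (theta_verts n (n * m)) (theta_edges n (n * m)) * (n + 2 * m + 2)"
proof -
  let ?V = "theta_verts n (n * m)" and ?E = "theta_edges n (n * m)"
  let ?k = "interval_impropriety ?V ?E"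
  note G = fin_simple_graph_theta[OF assms, of "n * m"]
  obtain \<alpha> where \<alpha>: "improper_interval_coloring ?k ?V ?E \<alpha>"
    using interval_impropriety_attained[OF G] .
  have fin: "finite (incident_edges ?E v)" for v
    using fin_simple_graph_finite_edges[OF G] by (simp add: incident_edges_def)
  have spread_c: "\<alpha> e \<le> \<alpha> e' + 1"
    if "p < n * m" "e \<in> incident_edges ?E (2 + n + p)" "e' \<in> incident_edges ?E (2 + n + p)" for p e e'
  proof (rule improper_interval_coloring_spread[OF \<alpha> _ fin])
    show "card (incident_edges ?E (2 + n + p)) \<le> Suc 1"
      unfolding incident_theta_c[OF that(1) assms]
      by (rule order_trans[OF card_insert_le_m1]) auto
  qed (use that in \<open>auto simp: theta_verts_def incident_edges_def\<close>)
  have spread_b: "\<alpha> e \<le> \<alpha> e' + m"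
    if "i < n" "e \<in> incident_edges ?E (2 + i)" "e' \<in> incident_edges ?E (2 + i)" for i e e'
  proof (rule improper_interval_coloring_spread[OF \<alpha> _ fin])
    let ?f = "\<lambda>p. {2 + i, 2 + n + p}"
    have "card (?f ` {p. p < n * m \<and> p mod n = i}) \<le> m"
      using card_residue_class_le[OF that(1), of m] card_image_le[of "{p. p < n * m \<and> p mod n = i}" ?f]
      by simp
    then show "card (incident_edges ?E (2 + i)) \<le> Suc m"
      unfolding incident_theta_b[OF that(1)]
      by (intro card_insert_le_m1) auto
  qed (use that in \<open>auto simp: theta_verts_def incident_edges_def\<close>)
  have spread_a: "\<alpha> e \<le> \<alpha> e' + (n - 1)"
    if "e \<in> incident_edges ?E 1" "e' \<in> incident_edges ?E 1" for e e'
  proof (rule improper_interval_coloring_spread[OF \<alpha> _ fin])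
    show "card (incident_edges ?E 1) \<le> Suc (n - 1)"
      unfolding incident_theta_a using card_image_le[of "{..<n}" "\<lambda>i. {1, 2 + i}"] assms by simp
  qed (use that in \<open>auto simp: theta_verts_def incident_edges_def\<close>)
  have "\<alpha> e \<le> \<alpha> e' + (n + 2 * m + 1)"
    if e: "e \<in> incident_edges ?E 0" "e' \<in> incident_edges ?E 0" for e e'
  proof -
    obtain p q where pq: "p < n * m" "q < n * m" "e = {0, 2 + n + p}" "e' = {0, 2 + n + q}"
      using e unfolding incident_theta_d by blast
    have mod: "x mod n < n" for x using assms by simp
    \<comment> \<open>The walk uses the edges \<open>e\<close>, \<open>?bc p\<close>,
      \<open>?ab p\<close>, \<open>?ab q\<close>, \<open>?bc q\<close>, \<open>e'\<close> in this
      order; consecutive ones share a vertex other than \<open>d\<close>.\<close>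
    let ?bc = "\<lambda>p. {2 + p mod n, 2 + n + p}" and ?ab = "\<lambda>p. {1, 2 + p mod n}"
    have "\<alpha> e \<le> \<alpha> (?bc p) + 1"
      by (rule spread_c[OF pq(1)]) (unfold incident_theta_c[OF pq(1) assms] pq, auto)
    moreover have "\<alpha> (?bc p) \<le> \<alpha> (?ab p) + m"
      by (rule spread_b[OF mod[of p]]) (unfold incident_theta_b[OF mod], use pq in auto)
    moreover have "\<alpha> (?ab p) \<le> \<alpha> (?ab q) + (n - 1)"
      by (rule spread_a) (unfold incident_theta_a, use mod in auto)
    moreover have "\<alpha> (?ab q) \<le> \<alpha> (?bc q) + m"
      by (rule spread_b[OF mod[of q]]) (unfold incident_theta_b[OF mod], use pq in auto)
    moreover have "\<alpha> (?bc q) \<le> \<alpha> e' + 1"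
      by (rule spread_c[OF pq(2)]) (unfold incident_theta_c[OF pq(2) assms] pq, auto)
    ultimately show ?thesis using assms by linarith
  qed
  then have "card (incident_edges ?E 0) \<le> ?k * Suc (n + 2 * m + 1)"
    using \<alpha> by (intro card_le_impropriety_times_span[OF _ _ fin])
      (auto simp: improper_interval_coloring_def theta_verts_def)
  moreover have "card (incident_edges ?E 0) = n * m"
    unfolding incident_theta_d by (subst card_image) (auto simp: inj_on_def doubleton_eq_iff)
  ultimately show ?thesis by simp
qed

section \<open>Attaining every intermediate value\<close>

text \<open>\<open>f\<close> may fall by any amount, but upward it moves by at most one: if
  \<open>f i < k \<le> f (Suc i)\<close>, then \<open>f (Suc i) = k\<close>.\<close>

lemma nat_intermediate_value_Suc_le:
  fixes f :: "nat \<Rightarrow> nat"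
  assumes "a \<le> b" "f a \<le> k" "k \<le> f b" "\<And>i. a \<le> i \<Longrightarrow> f (Suc i) \<le> Suc (f i)"
  shows "\<exists>i. f i = k"
  using assms(1,3)
proof (induction b rule: dec_induct)
  case base
  then show ?case using assms(2) by (intro exI[of _ a]) simp
next
  case (step i)
  show ?case
  proof (cases "k \<le> f i")
    case True
    then show ?thesis by (rule step.IH)
  next
    case False
    then have "f (Suc i) = k" using assms(4)[OF step.hyps(1)] step.prems by simp
    then show ?thesis ..
  qed
qed

theorem theorem15:
  fixes k :: nat
  assumes "k \<ge> 1"
  shows "\<exists>(V :: nat set) (E :: nat set set). bipartite_graph V E \<and> interval_impropriety V E = k"
proof -
  \<comment> \<open>With \<open>m = n\<close> the lower bound reads
    \<open>n * n \<le> f (n * n) * (3 * n + 2)\<close>. For \<open>n = 4 * k\<close>, a value of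
    \<open>f (n * n)\<close> below \<open>k\<close> would give
    \<open>4 * (k * k) \<le> 2 * k\<close>, impossible for positive \<open>k\<close>.\<close>
  define n where "n = 4 * k"
  have n: "0 < n" using assms by (simp add: n_def)
  define f where "f N = interval_impropriety (theta_verts n N) (theta_edges n N)" for N
  have "k \<le> f (n * n)"
  proof (rule ccontr)
    assume "\<not> k \<le> f (n * n)"
    then have "f (n * n) * (3 * n + 2) \<le> k * (3 * n + 2)" by (intro mult_right_mono) auto
    moreover have "n * n \<le> f (n * n) * (3 * n + 2)"
      using interval_impropriety_theta_ge[OF n, of n] by (simp add: f_def)
    ultimately have "n * n \<le> k * (3 * n + 2)" by (rule order_trans[rotated])
    then have "16 * (k * k) \<le> 12 * (k * k) + 2 * k" by (simp add: n_def algebra_simps)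
    moreover have "k \<le> k * k" by simp
    ultimately show False using assms by linarith
  qed
  moreover have "f n \<le> k"
    using interval_impropriety_theta_diagonal_le[OF n] assms by (simp add: f_def)
  moreover have "f (Suc N) \<le> Suc (f N)" if "n \<le> N" for N
    using interval_impropriety_theta_Suc[OF n that] by (simp add: f_def)
  moreover have "n \<le> n * n" by simp
  ultimately obtain N where "f N = k"
    using nat_intermediate_value_Suc_le[of n "n * n" f k] by blast
  then show ?thesis using bipartite_theta[OF n] unfolding f_def by blast
qed

end
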